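(* Let $R,r>0$. If a connected $\mu$-uniform graph $\Gamma$ has an $(R,r)$-decomposition, then $$h(\Gamma)\ \ge\ \frac{r^2(\mu-1)}{(\mu^{R+1}-1)(\mu+r)^2+2r\mu(\mu-1)}.$$
   Context: Graphs carry the length metric in which every edge has length $1$. A graph is $\mu$-uniform if each vertex has at most $\mu$ neighbors. For a graph $\Gamma$, $h(\Gamma)=\inf_A|\partial A|/|A|$, where $A$ ranges over non-empty finite sets of vertices of $\Gamma$ and $\partial A$ is the set of vertices at distance exactly $1$ from $A$. Given a graph $\Gamma$ and positive constants $R,r$, a family of subgraphs $\{\Gamma_s\}_{s\in S}$ of $\Gamma$ is an $(R,r)$-decomposition of $\Gamma$ if: (1) $\bigcup_{s\in S}\Gamma_s=\Gamma$; (2) for each $s\ne t$ in $S$, $\Gamma_s\cap\Gamma_t$ is either a (finite or infinite) set of vertices or the empty set, and $\Gamma_s\setminus\Gamma_t\ne\emptyset$; (3) there is a partition $\{S_1,S_2\}$ of $S$ such that (3.1) $S_1\ne\emptyset$ and $h(\Gamma_s)\ge r$ for every $s\in S_1$; (3.2) for every $s\in S_2$, setting $V_s=\Gamma_s\cap\big(\bigcup_{t\in S_1}\Gamma_t\big)$ and $W_s=\bigcup_{v\in V_s}\bar B_{\Gamma_s}(v,R)$ (where $\bar B_{\Gamma_s}$ denotes the closed ball in $\Gamma_s$), and letting $\{\Gamma_{s,j}\}_{j\in J_s}$ be the connected components of the subgraph of $\Gamma_s$ induced by $V(\Gamma_s)\setminus W_s$, one has $V_s\ne\emptyset$ and $h(\Gamma_{s,j})\ge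 r$ for every $j\in J_s$. *)

theory Defs
  imports "Graph_Theory.Graph_Theory"
begin

text \<open>
  Undirected graphs are symmetric digraphs, as in the library's locale \<open>graph\<close>, but without its
  finiteness assumption. For such graphs the strongly connected components \<open>pre_digraph.sccs\<close>
  are the usual connected components.
\<close>

locale simple_graph = loopfree_digraph + nomulti_digraph + sym_digraph

text \<open>
  The length metric with all edges of length 1, restricted to vertices. Its value is \<open>\<infinity>\<close> for
  vertices in different components.
\<close>

definition gdist :: "('a, 'b) pre_digraph \<Rightarrow> 'a \<Rightarrow> 'a \<Rightarrow> ereal" where
  "gdist G u v = wf_digraph.\<mu> G (\<lambda>_. 1) u v"

definition vert_cball :: "('a, 'b) pre_digraph \<Rightarrow> 'a \<Rightarrow> real \<Rightarrow> 'a set" where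
  "vert_cball G v R = {w \<in> verts G. gdist G v w \<le> ereal R}"

definition vert_boundary :: "('a, 'b) pre_digraph \<Rightarrow> 'a set \<Rightarrow> 'a set" where
  "vert_boundary G A = {v \<in> verts G. (INF a\<in>A. gdist G a v) = 1}"

text \<open>
  The case distinction is needed because \<open>card\<close> is 0 on infinite sets, and boundaries of finite sets
  can be infinite when the graph is not locally finite.
\<close>

definition cheeger :: "('a, 'b) pre_digraph \<Rightarrow> ereal" where
  "cheeger G = (INF A \<in> {A. A \<subseteq> verts G \<and> finite A \<and> A \<noteq> {}}.
     if finite (vert_boundary G A) then ereal (real (card (vert_boundary G A)) / real (card A))
     else \<infinity>)"

definition uniform_graph :: "nat \<Rightarrow> ('a, 'b) pre_digraph \<Rightarrow> bool" where
  "uniform_graph m G \<longleftrightarrow>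
     (\<forall>v \<in> verts G. finite {w. v \<rightarrow>\<^bsub>G\<^esub> w} \<and> card {w. v \<rightarrow>\<^bsub>G\<^esub> w} \<le> m)"

definition contact_verts :: "('i \<Rightarrow> ('a, 'b) pre_digraph) \<Rightarrow> 'i set \<Rightarrow> 'i \<Rightarrow> 'a set" where
  "contact_verts \<Gamma> S1 s = verts (\<Gamma> s) \<inter> (\<Union>t\<in>S1. verts (\<Gamma> t))"

definition contact_nbhd :: "real \<Rightarrow> ('i \<Rightarrow> ('a, 'b) pre_digraph) \<Rightarrow> 'i set \<Rightarrow> 'i \<Rightarrow> 'a set" where
  "contact_nbhd R \<Gamma> S1 s = (\<Union>v \<in> contact_verts \<Gamma> S1 s. vert_cball (\<Gamma> s) v R)"

text \<open>
  Subgraphs are compared as subsets of the metric graph. So \<open>\<Gamma> s \<inter> \<Gamma> t\<close> consists of vertices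
  iff there is no common edge, and \<open>\<Gamma> s - \<Gamma> t\<close> is non-empty iff some vertex or some edge of
  \<open>\<Gamma> s\<close> does not belong to \<open>\<Gamma> t\<close>. The block \<open>S2\<close> of the partition may be empty.
\<close>

definition decomposition ::
  "real \<Rightarrow> real \<Rightarrow> ('a, 'b) pre_digraph \<Rightarrow> 'i set \<Rightarrow> ('i \<Rightarrow> ('a, 'b) pre_digraph) \<Rightarrow> bool" where
  "decomposition R r G S \<Gamma> \<longleftrightarrow>
     (\<forall>s\<in>S. simple_graph (\<Gamma> s) \<and> subgraph (\<Gamma> s) G) \<and>
     pre_digraph.Union G (\<Gamma> ` S) = G \<and>
     (\<forall>s\<in>S. \<forall>t\<in>S. s \<noteq> t \<longrightarrow>
        arcs (\<Gamma> s) \<inter> arcs (\<Gamma> t) = {} \<and>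
        (verts (\<Gamma> s) - verts (\<Gamma> t) \<noteq> {} \<or> arcs (\<Gamma> s) - arcs (\<Gamma> t) \<noteq> {})) \<and>
     (\<exists>S1 S2. S1 \<union> S2 = S \<and> S1 \<inter> S2 = {} \<and>
        S1 \<noteq> {} \<and> (\<forall>s\<in>S1. cheeger (\<Gamma> s) \<ge> ereal r) \<and>
        (\<forall>s\<in>S2. contact_verts \<Gamma> S1 s \<noteq> {} \<and>
           (\<forall>C \<in> pre_digraph.sccs (\<Gamma> s \<restriction> (verts (\<Gamma> s) - contact_nbhd R \<Gamma> S1 s)).
              cheeger C \<ge> ereal r)))"

end

theory Submission
  imports Defs
begin

text \<open>
  The graphs of the first block together with the components of the graphs of the second block form
  an arc-disjoint family \<open>F\<close> of subgraphs of Cheeger constant at least \<open>r\<close>. For a finite vertex set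
  \<open>A\<close>, every member of \<open>F\<close> contributes at least \<open>r\<close> times the number of its vertices in \<open>A\<close> to the
  arcs that lead from \<open>A\<close> to \<open>\<partial>A\<close>, and there are at most \<open>m \<cdot> |\<partial>A|\<close> such arcs. A vertex of \<open>A\<close>
  outside \<open>F\<close> is joined by a path of length at most \<open>R\<close> to a vertex of \<open>F\<close>; that path either stays
  in \<open>A\<close> or passes through \<open>\<partial>A\<close>. So the remaining vertices of \<open>A\<close> lie in balls of radius \<open>R\<close>
  around \<open>\<partial>A\<close> and the part of \<open>A\<close> covered by \<open>F\<close>.
\<close>

section \<open>Walks, distances, vertex boundaries and the Cheeger constant\<close>

lemma relpow_mono:
  fixes R S :: "'a rel"
  assumes "R \<subseteq> S"
  shows "R ^^ k \<subseteq> S ^^ k"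
  by (induction k) (use assms in \<open>auto simp: relcomp_mono\<close>)

lemma awalk_imp_relpow:
  assumes "wf_digraph G" "pre_digraph.awalk G u p v"
  shows "(u, v) \<in> arcs_ends G ^^ length p"
  using assms(2)
proof (induction p arbitrary: u)
  case Nil
  then show ?case by (simp add: wf_digraph.awalk_Nil_iff[OF assms(1)])
next
  case (Cons e p)
  then have "e \<in> arcs G" "tail G e = u" "(head G e, v) \<in> arcs_ends G ^^ length p"
    using wf_digraph.awalk_Cons_iff[OF assms(1)] by auto
  then have "(u, head G e) \<in> arcs_ends G" by (auto simp: arcs_ends_conv)
  then show ?case
    unfolding list.size(4) add_0_right Nat.add_Suc_right One_nat_def
    using \<open>(head G e, v) \<in> _\<close> by (rule relpow_Suc_I2)
qed

lemma relpow_imp_awalk: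
  assumes "wf_digraph G" "u \<in> verts G" "(u, v) \<in> arcs_ends G ^^ k"
  shows "\<exists>p. pre_digraph.awalk G u p v \<and> length p = k"
  using assms(2,3)
proof (induction k arbitrary: u)
  case 0
  then show ?case using wf_digraph.awalk_Nil_iff[OF assms(1)] by auto
next
  case (Suc k)
  then obtain w where w: "(u, w) \<in> arcs_ends G" "(w, v) \<in> arcs_ends G ^^ k"
    by (meson relpow_Suc_D2)
  then obtain e where e: "e \<in> arcs G" "tail G e = u" "head G e = w"
    by (auto simp: arcs_ends_conv)
  then have "w \<in> verts G" using wf_digraph.head_in_verts[OF assms(1)] by auto
  then obtain p where "pre_digraph.awalk G w p v" "length p = k"
    using Suc.IH w(2) by blast
  then have "pre_digraph.awalk G u (e # p) v" "length (e # p) = Suc k"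
    using e Suc.prems wf_digraph.awalk_Cons_iff[OF assms(1)] by auto
  then show ?case by blast
qed

lemma awalk_cost_one:
  fixes G :: "('a, 'b) pre_digraph" and p :: "'b list"
  assumes "wf_digraph G"
  shows "wf_digraph.awalk_cost (\<lambda>_. 1) p = real (length p)"
  unfolding wf_digraph.awalk_cost_def[OF assms] by (induction p) auto

text \<open>Distance is an infimum of walk costs, and an infimum lies strictly below
  \<open>c\<close> exactly when some walk costs less than \<open>c\<close>; the strict form thus
  avoids any question of attainment. Membership of \<open>u\<close> in \<open>verts G\<close> is
  stated separately because the zeroth relation power relates every point to itself, inside the
  graph or not.\<close>

lemma gdist_less_iff:
  assumes "wf_digraph G"
  shows "gdist G u v < ereal c \<longleftrightarrow> u \<in> verts G \<and> (\<exists>k. real k < c \<and> (u, v) \<in> arcs_ends G ^^ k)"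
proof -
  have "gdist G u v < ereal c \<longleftrightarrow> (\<exists>p. pre_digraph.awalk G u p v \<and> real (length p) < c)"
    unfolding gdist_def wf_digraph.\<mu>_def[OF assms] by (auto simp: INF_less_iff awalk_cost_one[OF assms])
  also have "\<dots> \<longleftrightarrow> u \<in> verts G \<and> (\<exists>k. real k < c \<and> (u, v) \<in> arcs_ends G ^^ k)"
    using awalk_imp_relpow[OF assms] relpow_imp_awalk[OF assms]
    by (metis assms wf_digraph.awalk_hd_in_verts)
  finally show ?thesis .
qed

lemma gdist_le:
  assumes "wf_digraph G" "u \<in> verts G" "(u, v) \<in> arcs_ends G ^^ k"
  shows "gdist G u v \<le> ereal (real k)"
proof (rule ereal_le_epsilon2)
  fix e :: real
  assume "0 < e"
  then have "gdist G u v < ereal (real k + e)"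
    unfolding gdist_less_iff[OF assms(1)] using assms(2,3) by (auto intro!: exI[of _ k])
  then show "gdist G u v \<le> ereal (real k) + ereal e" by (simp add: less_imp_le)
qed

lemma in_vert_cballD:
  assumes "wf_digraph G" "w \<in> vert_cball G v R"
  obtains k where "k \<le> nat \<lfloor>R\<rfloor>" "(v, w) \<in> arcs_ends G ^^ k"
proof -
  have "gdist G v w \<le> ereal R" using assms(2) by (auto simp: vert_cball_def)
  \<comment> \<open>Walk lengths are integers, so the strict bound by the floor plus one recovers
    the non-strict bound by the floor.\<close>
  also have "\<dots> < ereal (of_int \<lfloor>R\<rfloor> + 1)" by simp
  finally obtain k where "real k < of_int \<lfloor>R\<rfloor> + 1" "(v, w) \<in> arcs_ends G ^^ k"
    unfolding gdist_less_iff[OF assms(1)] by auto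
  moreover from this have "k \<le> nat \<lfloor>R\<rfloor>" by linarith
  ultimately show thesis using that by blast
qed

lemma in_vert_boundary_iff:
  assumes "wf_digraph G"
  shows "v \<in> vert_boundary G A \<longleftrightarrow> v \<notin> A \<and> (\<exists>a\<in>A. (a, v) \<in> arcs_ends G)"
proof
  assume v: "v \<in> vert_boundary G A"
  have "v \<notin> A"
  proof
    assume "v \<in> A"
    have "gdist G v v < ereal 1"
      unfolding gdist_less_iff[OF assms] using v by (auto simp: vert_boundary_def intro!: exI[of _ 0])
    then have "(INF a\<in>A. gdist G a v) < ereal 1" using \<open>v \<in> A\<close> by (auto simp: INF_less_iff)
    then show False using v by (simp add: vert_boundary_def one_ereal_def)
  qed
  \<comment> \<open>Relaxing the value 1 to the strict bound 2 produces an actual walk of length 0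
    or 1 from \<open>A\<close>; length 0 would put \<open>v\<close> in \<open>A\<close>.\<close>
  have "(INF a\<in>A. gdist G a v) < ereal 2" using v by (simp add: vert_boundary_def one_ereal_def)
  then obtain a k where a: "a \<in> A" "real k < 2" "(a, v) \<in> arcs_ends G ^^ k"
    by (auto simp: INF_less_iff gdist_less_iff[OF assms])
  then have "k = 0 \<or> k = 1" by linarith
  then show "v \<notin> A \<and> (\<exists>a\<in>A. (a, v) \<in> arcs_ends G)" using a \<open>v \<notin> A\<close> by auto
next
  assume "v \<notin> A \<and> (\<exists>a\<in>A. (a, v) \<in> arcs_ends G)"
  then obtain a where v: "v \<notin> A" and a: "a \<in> A" "(a, v) \<in> arcs_ends G" by blast
  have in_verts: "a \<in> verts G" "v \<in> verts G"
    using a(2) wf_digraph.wellformed[OF assms] by (auto simp: arcs_ends_conv)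
  have "\<not> (INF a\<in>A. gdist G a v) < ereal 1"
    using v by (auto simp: INF_less_iff gdist_less_iff[OF assms])
  moreover have "(INF a\<in>A. gdist G a v) \<le> ereal 1"
    using gdist_le[OF assms in_verts(1), of v 1] a by (auto intro: INF_lower2)
  ultimately show "v \<in> vert_boundary G A"
    using in_verts(2) by (simp add: vert_boundary_def one_ereal_def)
qed

text \<open>Clearing the denominator lets the inequality cover empty \<open>B\<close> as well, so it
  applies to the trace of \<open>A\<close> on any member of the family, even one that misses
  \<open>A\<close>.\<close>

lemma cheeger_le_card_boundary:
  assumes "ereal r \<le> cheeger H" "B \<subseteq> verts H" "finite B" "finite (vert_boundary H B)"
  shows "r * real (card B) \<le> real (card (vert_boundary H B))"
proof (cases "B = {}")
  case False
  then have "cheeger H \<le> ereal (real (card (vert_boundary H B)) / real (card B))"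
    unfolding cheeger_def using assms(2-4) False by (intro INF_lower2[of B]) auto
  then have "r \<le> real (card (vert_boundary H B)) / real (card B)"
    using assms(1) by (metis ereal_less_eq(3) order_trans)
  moreover have "0 < card B" using False assms(3) by (simp add: card_gt_0_iff)
  ultimately show ?thesis by (simp add: pos_le_divide_eq)
qed simp

section \<open>Counting arcs and walks in a uniform graph\<close>

locale uniform_simple_graph = simple_graph +
  fixes m :: nat
  assumes uniform: "uniform_graph m G"
begin

lemma
  assumes "v \<in> verts G"
  shows finite_neighbours: "finite {w. v \<rightarrow> w}" and card_neighbours: "card {w. v \<rightarrow> w} \<le> m"
  using uniform assms by (auto simp: uniform_graph_def)

lemma finite_vert_boundary:
  assumes "finite A" "A \<subseteq> verts G"
  shows "finite (vert_boundary G A)"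
proof (rule finite_subset)
  show "vert_boundary G A \<subseteq> (\<Union>a\<in>A. {w. a \<rightarrow> w})"
    using in_vert_boundary_iff[OF wf_digraph] by blast
qed (use assms finite_neighbours in auto)

text \<open>Without multiple arcs, an arc is determined by its head and tail. By symmetry the tail
  is a neighbour of the head, which leaves at most \<open>m\<close> arcs per head.\<close>

lemma card_arcs_to_le:
  assumes "finite X" "X \<subseteq> verts G"
  shows "finite {e \<in> arcs G. head G e \<in> X}" "card {e \<in> arcs G. head G e \<in> X} \<le> m * card X"
proof -
  let ?E = "{e \<in> arcs G. head G e \<in> X}"
  let ?P = "SIGMA v:X. {w. v \<rightarrow> w}"
  let ?f = "\<lambda>e. (head G e, tail G e)"
  have inj: "inj_on ?f ?E"
    by (rule inj_onI) (auto intro: no_multi_arcs simp: arc_to_ends_def)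
  have sub: "?f ` ?E \<subseteq> ?P"
    using arcs_ends_symmetric[OF sym_arcs] by (auto simp: arcs_ends_conv)
  have fin: "finite ?P" using assms finite_neighbours by auto
  show "finite ?E" using finite_imageD[OF finite_subset[OF sub fin] inj] .
  have "card ?E = card (?f ` ?E)" using inj by (simp add: card_image)
  also have "\<dots> \<le> card ?P" by (rule card_mono[OF fin sub])
  also have "\<dots> = (\<Sum>v\<in>X. card {w. v \<rightarrow> w})"
    using assms finite_neighbours by (subst card_SigmaI) auto
  also have "\<dots> \<le> (\<Sum>v\<in>X. m)" using assms card_neighbours by (intro sum_mono) auto
  finally show "card ?E \<le> m * card X" by (simp add: mult.commute)
qed

text \<open>Members of \<open>F\<close> may share boundary vertices but not arcs. Each local
  boundary vertex is therefore charged to an arc entering it, and the charges of different members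
  add up without overlap.\<close>

lemma arc_disjoint_family_bound:
  assumes A: "finite A" "A \<subseteq> verts G"
    and sub: "\<And>H. H \<in> F \<Longrightarrow> subgraph H G"
    and cheeger: "\<And>H. H \<in> F \<Longrightarrow> ereal r \<le> cheeger H"
    and disj: "\<And>H K. H \<in> F \<Longrightarrow> K \<in> F \<Longrightarrow> H \<noteq> K \<Longrightarrow> arcs H \<inter> arcs K = {}"
    and r: "0 \<le> r"
  shows "r * real (card (A \<inter> (\<Union>H\<in>F. verts H))) \<le> real m * real (card (vert_boundary G A))"
proof -
  let ?B = "A \<inter> (\<Union>H\<in>F. verts H)"
  let ?D = "vert_boundary G A"
  have fin_D: "finite ?D" using A by (rule finite_vert_boundary)
  have D_verts: "?D \<subseteq> verts G" by (auto simp: vert_boundary_def)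
  let ?E = "\<lambda>H. {e \<in> arcs H. head G e \<in> ?D}"
  \<comment> \<open>\<open>F\<close> may be infinite. Choosing one member for each vertex of the
    finite set \<open>?B\<close> gives a finite subfamily \<open>F'\<close> that still covers
    \<open>?B\<close>.\<close>
  obtain h where h: "\<And>a. a \<in> ?B \<Longrightarrow> h a \<in> F \<and> a \<in> verts (h a)" by (metis IntD2 UN_E)
  define F' where "F' = h ` ?B"
  have F': "finite F'" "F' \<subseteq> F" using A h by (auto simp: F'_def)
  have fin_E: "finite (?E H)" if "H \<in> F" for H
    by (rule finite_subset[OF _ card_arcs_to_le(1)[OF fin_D D_verts]]) (use sub[OF that] in blast)
  have local_bound: "r * real (card (A \<inter> verts H)) \<le> real (card (?E H))" if "H \<in> F" for H
  proof -
    have H: "wf_digraph H" "tail H = tail G" "head H = head G" "arcs H \<subseteq> arcs G"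
      using sub[OF that] by (auto simp: subgraph_def compatible_def)
    \<comment> \<open>A boundary vertex taken in \<open>H\<close> belongs to \<open>H\<close> but
      not to the trace of \<open>A\<close> on \<open>H\<close>, hence lies outside \<open>A\<close>
      altogether and so in \<open>?D\<close>.\<close>
    have bd: "vert_boundary H (A \<inter> verts H) \<subseteq> head G ` ?E H"
    proof
      fix v
      assume "v \<in> vert_boundary H (A \<inter> verts H)"
      then obtain a where a: "v \<notin> A \<inter> verts H" "a \<in> A" "(a, v) \<in> arcs_ends H"
        by (auto simp: in_vert_boundary_iff[OF H(1)])
      then obtain e where e: "e \<in> arcs H" "tail G e = a" "head G e = v"
        using H by (auto simp: arcs_ends_conv)
      then have "v \<in> verts H" using wf_digraph.head_in_verts[OF H(1)] H(3) by metis
      moreover have "a \<rightarrow> v" using e H(4) by (auto simp: arcs_ends_conv)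
      ultimately have "v \<in> ?D" using a by (auto simp: in_vert_boundary_iff[OF wf_digraph])
      then show "v \<in> head G ` ?E H" using e by blast
    qed
    have "r * real (card (A \<inter> verts H)) \<le> real (card (vert_boundary H (A \<inter> verts H)))"
      using A finite_subset[OF bd] fin_E[OF that]
      by (intro cheeger_le_card_boundary[OF cheeger[OF that]]) auto
    also have "card (vert_boundary H (A \<inter> verts H)) \<le> card (head G ` ?E H)"
      using bd fin_E[OF that] by (intro card_mono) auto
    also have "\<dots> \<le> card (?E H)" using fin_E[OF that] by (rule card_image_le)
    finally show ?thesis by simp
  qed
  have "?B \<subseteq> (\<Union>H\<in>F'. A \<inter> verts H)"
  proof
    fix a
    assume a: "a \<in> ?B"
    then have "h a \<in> F'" by (simp add: F'_def)
    then show "a \<in> (\<Union>H\<in>F'. A \<inter> verts H)" using a h[OF a] by blast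
  qed
  \<comment> \<open>Vertices common to several members are counted repeatedly here, which is
    harmless for an upper bound on \<open>card ?B\<close>.\<close>
  then have "card ?B \<le> card (\<Union>H\<in>F'. A \<inter> verts H)"
    using A(1) F'(1) by (intro card_mono) auto
  also have "\<dots> \<le> (\<Sum>H\<in>F'. card (A \<inter> verts H))" using F'(1) by (rule card_UN_le)
  finally have "r * real (card ?B) \<le> r * real (\<Sum>H\<in>F'. card (A \<inter> verts H))"
    using r by (intro mult_left_mono of_nat_mono)
  also have "\<dots> \<le> (\<Sum>H\<in>F'. real (card (?E H)))"
    using local_bound F'(2) by (auto simp: sum_distrib_left intro!: sum_mono)
  also have "\<dots> = real (card (\<Union>H\<in>F'. ?E H))"
  proof -
    have "\<forall>H\<in>F'. \<forall>K\<in>F'. H \<noteq> K \<longrightarrow> ?E H \<inter> ?E K = {}"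
      using disj F'(2) by blast
    then show ?thesis using F' fin_E by (subst card_UN_disjoint) auto
  qed
  also have "card (\<Union>H\<in>F'. ?E H) \<le> card {e \<in> arcs G. head G e \<in> ?D}"
    using sub F'(2) by (intro card_mono card_arcs_to_le fin_D D_verts) blast
  also have "\<dots> \<le> m * card ?D" by (rule card_arcs_to_le(2)[OF fin_D D_verts])
  finally show ?thesis by simp
qed

text \<open>Walks of length \<open>k\<close> branch at most \<open>m\<close> ways at each step. The
  three claims are proved together because the induction step sums the neighbour bound over a set
  that must be finite and inside the graph.\<close>

lemma card_relpow_ball:
  assumes "v \<in> verts G"
  shows "finite {w. (v, w) \<in> arcs_ends G ^^ k} \<and> {w. (v, w) \<in> arcs_ends G ^^ k} \<subseteq> verts G \<and>
    card {w. (v, w) \<in> arcs_ends G ^^ k} \<le> m ^ k"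
proof (induction k)
  case 0
  have "{w. (v, w) \<in> arcs_ends G ^^ 0} = {v}" by auto
  then show ?case using assms by simp
next
  case (Suc k)
  let ?S = "{w. (v, w) \<in> arcs_ends G ^^ k}"
  have eq: "{w. (v, w) \<in> arcs_ends G ^^ Suc k} = (\<Union>u\<in>?S. {w. u \<rightarrow> w})" by auto
  have "card (\<Union>u\<in>?S. {w. u \<rightarrow> w}) \<le> (\<Sum>u\<in>?S. card {w. u \<rightarrow> w})"
    using Suc by (intro card_UN_le) simp
  also have "\<dots> \<le> (\<Sum>u\<in>?S. m)" using Suc card_neighbours by (intro sum_mono) auto
  also have "\<dots> \<le> m ^ Suc k" using Suc by (simp add: mult.commute)
  finally have "card (\<Union>u\<in>?S. {w. u \<rightarrow> w}) \<le> m ^ Suc k" .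
  moreover have "finite (\<Union>u\<in>?S. {w. u \<rightarrow> w})" using Suc finite_neighbours by auto
  moreover have "(\<Union>u\<in>?S. {w. u \<rightarrow> w}) \<subseteq> verts G" by (auto simp: arcs_ends_conv)
  ultimately show ?case unfolding eq by blast
qed

lemma card_relpow_nbhd:
  assumes "finite X" "X \<subseteq> verts G"
  shows "finite {w. \<exists>x\<in>X. \<exists>k\<le>n. (x, w) \<in> arcs_ends G ^^ k}"
    and "card {w. \<exists>x\<in>X. \<exists>k\<le>n. (x, w) \<in> arcs_ends G ^^ k} \<le> card X * (\<Sum>i\<le>n. m ^ i)"
proof -
  let ?N = "\<lambda>x k. {w. (x, w) \<in> arcs_ends G ^^ k}"
  have eq: "{w. \<exists>x\<in>X. \<exists>k\<le>n. (x, w) \<in> arcs_ends G ^^ k} = (\<Union>x\<in>X. \<Union>k\<in>{..n}. ?N x k)"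
    by auto
  have fin: "finite (\<Union>k\<in>{..n}. ?N x k)" if "x \<in> X" for x
    using card_relpow_ball that assms by blast
  show "finite {w. \<exists>x\<in>X. \<exists>k\<le>n. (x, w) \<in> arcs_ends G ^^ k}"
    unfolding eq using assms fin by auto
  have "card (\<Union>x\<in>X. \<Union>k\<in>{..n}. ?N x k) \<le> (\<Sum>x\<in>X. card (\<Union>k\<in>{..n}. ?N x k))"
    using assms(1) by (rule card_UN_le)
  also have "\<dots> \<le> (\<Sum>x\<in>X. \<Sum>k\<le>n. card (?N x k))"
    by (intro sum_mono card_UN_le) simp
  also have "\<dots> \<le> (\<Sum>x\<in>X. \<Sum>k\<le>n. m ^ k)"
    using card_relpow_ball assms by (intro sum_mono) blast
  finally show "card {w. \<exists>x\<in>X. \<exists>k\<le>n. (x, w) \<in> arcs_ends G ^^ k} \<le> card X * (\<Sum>i\<le>n. m ^ i)"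
    unfolding eq by simp
qed

text \<open>The last vertex of the walk outside \<open>A\<close> has its successor in
  \<open>A\<close>, so it lies in the boundary of \<open>A\<close>, and the rest of the walk is no
  longer than the whole. If there is no such vertex, the walk starts in \<open>A\<close>.\<close>

lemma relpow_into_set:
  assumes "(v, w) \<in> arcs_ends G ^^ k" "w \<in> A"
  shows "\<exists>j\<le>k. \<exists>u. (u, w) \<in> arcs_ends G ^^ j \<and> (u \<in> vert_boundary G A \<or> u = v \<and> v \<in> A)"
  using assms(1)
proof (induction k arbitrary: v)
  case 0
  then show ?case using assms(2) by auto
next
  case (Suc k)
  then obtain x where x: "v \<rightarrow> x" "(x, w) \<in> arcs_ends G ^^ k" by (meson relpow_Suc_D2)
  obtain j u where j: "j \<le> k" "(u, w) \<in> arcs_ends G ^^ j" "u \<in> vert_boundary G A \<or> u = x \<and> x \<in> A"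
    using Suc.IH[OF x(2)] by blast
  show ?case
  proof (cases "u \<in> vert_boundary G A")
    case True
    then show ?thesis using j by (meson le_SucI)
  next
    case False
    then have "x \<in> A" using j by blast
    \<comment> \<open>The arc runs from \<open>v\<close> into \<open>A\<close>, whereas the boundary
      is described by arcs leaving \<open>A\<close>; symmetry reverses it.\<close>
    then have "v \<in> vert_boundary G A \<or> v \<in> A"
      using x(1) arcs_ends_symmetric[OF sym_arcs] in_vert_boundary_iff[OF wf_digraph] by blast
    then show ?thesis using Suc.prems by blast
  qed
qed

end

section \<open>Components and the pieces of a decomposition\<close>

lemma sccs_arcs_disjoint:
  assumes "wf_digraph G" "C \<in> pre_digraph.sccs G" "D \<in> pre_digraph.sccs G" "C \<noteq> D"
  shows "arcs C \<inter> arcs D = {}"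
proof -
  have "wf_digraph C" "wf_digraph D" "tail C = tail G" "tail D = tail G"
    using pre_digraph.in_sccs_imp_induced[OF assms(2)] pre_digraph.in_sccs_imp_induced[OF assms(3)]
    by (auto simp: induced_subgraph_def subgraph_def compatible_def)
  then have "tail G e \<in> verts C \<inter> verts D" if "e \<in> arcs C \<inter> arcs D" for e
    using that wf_digraph.tail_in_verts by (metis IntD1 IntD2 IntI)
  then show ?thesis using wf_digraph.scc_disj[OF assms] by blast
qed

lemma in_verts_imp_in_scc:
  assumes "wf_digraph G" "v \<in> verts G"
  shows "\<exists>C\<in>pre_digraph.sccs G. v \<in> verts C"
proof -
  have "G \<restriction> pre_digraph.scc_of G v \<in> pre_digraph.sccs G"
    by (intro wf_digraph.in_verts_sccsD_sccs wf_digraph.scc_of_in_sccs_verts assms)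
  then show ?thesis
    using wf_digraph.in_scc_of_self[OF assms] by (metis induce_subgraph_verts)
qed

text \<open>Sets with infinite boundary contribute infinity to the infimum, so the inequality is
  asked only of sets with finite boundary.\<close>

lemma cheeger_ge_of_card_le:
  assumes "\<And>A. A \<subseteq> verts G \<Longrightarrow> finite A \<Longrightarrow> A \<noteq> {} \<Longrightarrow> finite (vert_boundary G A) \<Longrightarrow>
    c * real (card A) \<le> real (card (vert_boundary G A))"
  shows "ereal c \<le> cheeger G"
  unfolding cheeger_def
proof (rule INF_greatest)
  fix A
  assume A: "A \<in> {A. A \<subseteq> verts G \<and> finite A \<and> A \<noteq> {}}"
  then have "0 < card A" by (simp add: card_gt_0_iff)
  then show "ereal c \<le> (if finite (vert_boundary G A)
    then ereal (real (card (vert_boundary G A)) / real (card A)) else \<infinity>)"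
    using assms A by (auto simp: pos_le_divide_eq)
qed

text \<open>Here \<open>b\<close> is the number of vertices of \<open>A\<close> covered by the
  family \<open>F\<close>. Hiding \<open>F\<close> behind \<open>b\<close> reduces the remaining
  argument to eliminating \<open>b\<close> from two inequalities.\<close>

lemma decomposition_card_bounds:
  fixes \<Gamma> :: "'i \<Rightarrow> ('a, 'b) pre_digraph"
  assumes "simple_graph G" "uniform_graph m G" "decomposition R r G S \<Gamma>" "0 \<le> r"
    and A: "finite A" "A \<subseteq> verts G"
  obtains b where "r * real b \<le> real m * real (card (vert_boundary G A))"
    and "card A \<le> b + (card (vert_boundary G A) + b) * (\<Sum>i\<le>nat \<lfloor>R\<rfloor>. m ^ i)"
proof -
  interpret uniform_simple_graph G m
    using assms(1,2) by (intro uniform_simple_graph.intro uniform_simple_graph_axioms.intro)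
  obtain S1 S2 where S: "S1 \<union> S2 = S" "S1 \<inter> S2 = {}"
    and S1: "\<forall>s\<in>S1. ereal r \<le> cheeger (\<Gamma> s)"
    and S2: "\<forall>s\<in>S2. contact_verts \<Gamma> S1 s \<noteq> {} \<and>
      (\<forall>C \<in> pre_digraph.sccs (\<Gamma> s \<restriction> (verts (\<Gamma> s) - contact_nbhd R \<Gamma> S1 s)). ereal r \<le> cheeger C)"
    using assms(3) unfolding decomposition_def by (elim conjE exE) iprover
  have sub: "subgraph (\<Gamma> s) G" if "s \<in> S" for s
    using that assms(3) unfolding decomposition_def by blast
  have disj: "arcs (\<Gamma> s) \<inter> arcs (\<Gamma> t) = {}" if "s \<in> S" "t \<in> S" "s \<noteq> t" for s t
    using that assms(3)[unfolded decomposition_def, THEN conjunct2, THEN conjunct2, THEN conjunct1]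
    by simp
  have "verts (Union (\<Gamma> ` S)) = verts G"
    using assms(3) by (simp add: decomposition_def)
  then have cover: "verts G = (\<Union>s\<in>S. verts (\<Gamma> s))" by (simp add: Union_def)
  define K where "K s = \<Gamma> s \<restriction> (verts (\<Gamma> s) - contact_nbhd R \<Gamma> S1 s)" for s
  define P where "P s = (if s \<in> S1 then {\<Gamma> s} else pre_digraph.sccs (K s))" for s
  define F where "F = (\<Union>s\<in>S. P s)"
  have K_sub: "subgraph (K s) (\<Gamma> s)" if "s \<in> S" for s
    unfolding K_def using sub[OF that] by (intro induced_imp_subgraph wf_digraph.induced_induce) auto
  have K_wf: "wf_digraph (K s)" if "s \<in> S" for s using K_sub[OF that] by blast
  have P_sub: "subgraph H (\<Gamma> s)" if "s \<in> S" "H \<in> P s" for s H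
  proof (cases "s \<in> S1")
    case True
    then show ?thesis using that sub[OF that(1)] by (auto simp: P_def subgraph_def compatible_def)
  next
    case False
    then have "subgraph H (K s)"
      using that pre_digraph.in_sccs_imp_induced by (auto simp: P_def intro: induced_imp_subgraph)
    then show ?thesis using K_sub[OF that(1)] subgraph_trans by blast
  qed
  have F_disj: "arcs H \<inter> arcs H' = {}" if H: "H \<in> F" "H' \<in> F" and "H \<noteq> H'" for H H'
  proof -
    obtain s t where st: "s \<in> S" "H \<in> P s" "t \<in> S" "H' \<in> P t" using H by (auto simp: F_def)
    show ?thesis
    \<comment> \<open>Within one index, distinct members are distinct components. Across indices,
      disjointness is inherited from the decomposition.\<close>
    proof (cases "s = t")
      case True
      then show ?thesis using st \<open>H \<noteq> H'\<close> sccs_arcs_disjoint[OF K_wf[OF st(1)]]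
        by (auto simp: P_def split: if_splits)
    next
      case False
      then show ?thesis
        using disj[OF st(1,3)] P_sub[OF st(1,2)] P_sub[OF st(3,4)] by (auto simp: subgraph_def)
    qed
  qed
  let ?B = "A \<inter> (\<Union>H\<in>F. verts H)"
  let ?D = "vert_boundary G A"
  let ?n = "nat \<lfloor>R\<rfloor>"
  have bound: "r * real (card ?B) \<le> real m * real (card ?D)"
  proof (rule arc_disjoint_family_bound[OF A _ _ F_disj assms(4)])
    fix H
    assume "H \<in> F"
    then obtain s where s: "s \<in> S" "H \<in> P s" by (auto simp: F_def)
    show "subgraph H G" using P_sub[OF s] sub[OF s(1)] subgraph_trans by blast
    show "ereal r \<le> cheeger H"
      using s S S1 S2 by (auto simp: P_def K_def split: if_splits)
  qed
  define N where "N = {w. \<exists>x\<in>?D \<union> ?B. \<exists>k\<le>?n. (x, w) \<in> arcs_ends G ^^ k}"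
  have fin: "finite (?D \<union> ?B)" "?D \<union> ?B \<subseteq> verts G"
    using finite_vert_boundary[OF A] A by (auto simp: vert_boundary_def)
  have "A \<subseteq> ?B \<union> N"
  proof
    fix w
    assume w: "w \<in> A"
    then obtain s where s: "s \<in> S" "w \<in> verts (\<Gamma> s)" using cover A by blast
    \<comment> \<open>In the first two cases \<open>w\<close> lies in a member of \<open>F\<close>:
      all of \<open>\<Gamma> s\<close>, or a component of \<open>K s\<close>. What remains is the
      neighbourhood deleted in forming \<open>K s\<close>.\<close>
    consider "s \<in> S1" | "s \<notin> S1" "w \<in> verts (K s)" | "w \<in> contact_nbhd R \<Gamma> S1 s"
      using s by (auto simp: K_def)
    then show "w \<in> ?B \<union> N"
    proof cases
      case 1
      then show ?thesis using w s by (auto simp: F_def P_def)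
    next
      case 2
      then obtain C where "C \<in> pre_digraph.sccs (K s)" "w \<in> verts C"
        using in_verts_imp_in_scc[OF K_wf[OF s(1)] 2(2)] by auto
      then show ?thesis using w s 2 by (auto simp: F_def P_def)
    next
      case 3
      then obtain v where v: "v \<in> contact_verts \<Gamma> S1 s" "w \<in> vert_cball (\<Gamma> s) v R"
        by (auto simp: contact_nbhd_def)
      \<comment> \<open>The centre \<open>v\<close> of the ball lies in a first-block graph, which
        is itself a member of \<open>F\<close>; hence \<open>v\<close> is in \<open>?B\<close> as
        soon as it is in \<open>A\<close>.\<close>
      then obtain t where t: "t \<in> S1" "v \<in> verts (\<Gamma> t)" by (auto simp: contact_verts_def)
      have "wf_digraph (\<Gamma> s)" using sub[OF s(1)] by blast
      then obtain k where k: "k \<le> ?n" "(v, w) \<in> arcs_ends (\<Gamma> s) ^^ k"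
        using in_vert_cballD v(2) by metis
      have "arcs_ends (\<Gamma> s) \<subseteq> arcs_ends G"
        using sub[OF s(1)] by (auto simp: arcs_ends_conv subgraph_def compatible_def)
      then have "(v, w) \<in> arcs_ends G ^^ k" using k(2) relpow_mono by blast
      then obtain j u where j: "j \<le> k" "(u, w) \<in> arcs_ends G ^^ j" "u \<in> ?D \<or> u = v \<and> v \<in> A"
        using relpow_into_set[OF _ w, of v k] by blast
      moreover have "v \<in> A \<Longrightarrow> v \<in> ?B" using t S by (auto simp: F_def P_def)
      ultimately show ?thesis using k(1) unfolding N_def by (blast intro: order_trans)
    qed
  qed
  then have "card A \<le> card (?B \<union> N)"
    using card_relpow_nbhd(1)[OF fin] A by (intro card_mono) (auto simp: N_def)
  also have "\<dots> \<le> card ?B + card N" by (rule card_Un_le)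
  also have "\<dots> \<le> card ?B + card (?D \<union> ?B) * (\<Sum>i\<le>?n. m ^ i)"
    using card_relpow_nbhd(2)[OF fin] by (simp add: N_def)
  also have "\<dots> \<le> card ?B + (card ?D + card ?B) * (\<Sum>i\<le>?n. m ^ i)"
    by (intro add_left_mono mult_right_mono card_Un_le) simp
  finally show thesis using that bound by blast
qed

section \<open>Arithmetic of the final bound\<close>

text \<open>The index runs from 0 through the floor of \<open>R\<close>, so the geometric sum has
  exponent floor plus one, which is at most \<open>R + 1\<close>. A base of at least 2 keeps the
  denominator positive and the power monotone in its exponent.\<close>

lemma sum_power_le_powr:
  fixes m :: nat
  assumes "2 \<le> m" "0 < R"
  shows "real (\<Sum>i\<le>nat \<lfloor>R\<rfloor>. m ^ i) \<le> (real m powr (R + 1) - 1) / (real m - 1)"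
proof -
  have "real (\<Sum>i\<le>nat \<lfloor>R\<rfloor>. m ^ i) = (\<Sum>i<Suc (nat \<lfloor>R\<rfloor>). real m ^ i)"
    by (simp add: lessThan_Suc_atMost)
  also have "\<dots> = (real m ^ Suc (nat \<lfloor>R\<rfloor>) - 1) / (real m - 1)"
    using assms by (subst geometric_sum) auto
  also have "real m ^ Suc (nat \<lfloor>R\<rfloor>) = real m powr real (Suc (nat \<lfloor>R\<rfloor>))"
    using assms by (subst powr_realpow) auto
  also have "(real m powr real (Suc (nat \<lfloor>R\<rfloor>)) - 1) / (real m - 1)
    \<le> (real m powr (R + 1) - 1) / (real m - 1)"
    using assms by (intro divide_right_mono diff_right_mono powr_mono) auto
  finally show ?thesis .
qed

theorem theorem6p1:
  fixes G :: "('a, 'b) pre_digraph"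
    and S :: "'i set"
    and \<Gamma> :: "'i \<Rightarrow> ('a, 'b) pre_digraph"
    and m :: nat
    and R r :: real
  assumes "R > 0" and "r > 0"
    and "simple_graph G"
    and "Digraph_Component.connected G"
    and "uniform_graph m G"
    and "decomposition R r G S \<Gamma>"
  shows "cheeger G \<ge> ereal (r\<^sup>2 * (real m - 1) /
           ((real m powr (R + 1) - 1) * (real m + r)\<^sup>2 + 2 * r * real m * (real m - 1)))"
proof (rule cheeger_ge_of_card_le)
  fix A
  assume A: "A \<subseteq> verts G" "finite A" "A \<noteq> {}"
  let ?d = "real (card (vert_boundary G A))"
  let ?N = "real (\<Sum>i\<le>nat \<lfloor>R\<rfloor>. m ^ i)"
  obtain b where b: "r * real b \<le> real m * ?d"
    and bA: "card A \<le> b + (card (vert_boundary G A) + b) * (\<Sum>i\<le>nat \<lfloor>R\<rfloor>. m ^ i)"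
    using decomposition_card_bounds[OF assms(3,5,6) _ A(2,1)] assms(2) by (auto simp: less_imp_le)
  have cardA: "real (card A) \<le> real b + (?d + real b) * ?N"
    using bA by (metis of_nat_add of_nat_le_iff of_nat_mult)
  \<comment> \<open>Degenerate values are separated before dividing by \<open>m - 1\<close>. For
    \<open>m = 0\<close>, \<open>0 powr (R + 1)\<close> is 0 and the constant is 1, while
    \<open>b = 0\<close> and \<open>?N = 1\<close> give \<open>card A \<le> ?d\<close>. For
    \<open>m = 1\<close> the constant is 0/0, which is 0 by convention.\<close>
  consider "m = 0" | "m = 1" | "2 \<le> m" by linarith
  then show "r\<^sup>2 * (real m - 1) / ((real m powr (R + 1) - 1) * (real m + r)\<^sup>2 +
    2 * r * real m * (real m - 1)) * real (card A) \<le> ?d"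
  proof cases
    case 1
    then have "b = 0" using b assms(2) by (simp add: mult_le_0_iff)
    moreover have "?N = 1" using 1 by (simp add: power_0_left)
    ultimately have "real (card A) \<le> ?d" using cardA by simp
    then show ?thesis using 1 assms(2) by (simp add: divide_simps)
  next
    case 2
    then show ?thesis by simp
  next
    case 3
    define L where "L = (real m powr (R + 1) - 1) / (real m - 1)"
    have L: "?N \<le> L" unfolding L_def by (rule sum_power_le_powr[OF 3 assms(1)])
    have "0 \<le> L" using L by (rule order_trans[rotated]) (simp add: sum_nonneg)
    \<comment> \<open>\<open>Q\<close> is the denominator of the claim divided by
      \<open>m - 1\<close>, so the target constant becomes \<open>r\<^sup>2 / Q\<close>.\<close>
    define Q where "Q = L * (real m + r)\<^sup>2 + 2 * r * real m"
    have Q: "0 < Q" unfolding Q_def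
      using \<open>0 \<le> L\<close> assms(2) 3 by (intro add_nonneg_pos mult_nonneg_nonneg) auto
    have eq: "r\<^sup>2 * (real m - 1) / ((real m powr (R + 1) - 1) * (real m + r)\<^sup>2 +
      2 * r * real m * (real m - 1)) = r\<^sup>2 / Q"
    proof -
      have "(real m powr (R + 1) - 1) * (real m + r)\<^sup>2 + 2 * r * real m * (real m - 1)
        = Q * (real m - 1)"
        using 3 by (simp add: Q_def L_def field_simps)
      then show ?thesis using 3 by simp
    qed
    have "real (card A) \<le> real b + (?d + real b) * L"
      using cardA L by (meson add_left_mono mult_left_mono of_nat_0_le_iff add_nonneg_nonneg order_trans)
    \<comment> \<open>The factor \<open>r\<close> turns \<open>b\<close> into \<open>r * b\<close>,
      which is then replaced by its bound \<open>m * ?d\<close>.\<close>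
    then have "r * real (card A) \<le> r * (real b + (?d + real b) * L)"
      using assms(2) by simp
    also have "\<dots> = r * real b * (1 + L) + r * ?d * L" by (simp add: algebra_simps)
    also have "\<dots> \<le> real m * ?d * (1 + L) + r * ?d * L"
      using b \<open>0 \<le> L\<close> by (intro add_right_mono mult_right_mono) auto
    also have "\<dots> = (L * (real m + r) + real m) * ?d" by (simp add: algebra_simps)
    finally have "r * (r * real (card A)) \<le> r * ((L * (real m + r) + real m) * ?d)"
      using assms(2) by simp
    also have "\<dots> = (L * (real m + r) * r + r * real m) * ?d" by (simp add: algebra_simps)
    \<comment> \<open>The estimate so far is stronger than the claim: \<open>r\<close> is enlarged
      to \<open>m + r\<close> in the first summand, and \<open>r * m\<close> is doubled in the
      second.\<close>
    also have "\<dots> \<le> Q * ?d"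
      unfolding Q_def power2_eq_square mult.assoc[symmetric]
      using \<open>0 \<le> L\<close> assms(2) by (intro mult_right_mono add_mono mult_left_mono) auto
    finally show ?thesis
      unfolding eq using Q by (simp add: pos_divide_le_eq power2_eq_square mult_ac)
  qed
qed

end
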